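(* If $\Phi$ is the canonical twisting on the partition monoid $\mathcal P_n$ with $n\geq2$, then $$\bigl\langle E(\mathbb Z\times_\Phi^1\mathcal P_n)\bigr\rangle=\{(0,1)\}\cup\bigl(\mathbb Z\times\operatorname{Sing}(\mathcal P_n)\bigr).$$
   Context: Write $\mathbf n=\{1,\dots,n\}$, $\mathbf n'=\{1',\dots,n'\}$, $\mathbf n''=\{1'',\dots,n''\}$ (disjoint copies). $\mathcal P_n$ is the set of all set partitions of $\mathbf n\cup\mathbf n'$. A partition is identified with any graph on $\mathbf n\cup\mathbf n'$ whose connected components are its blocks. For $a,b\in\mathcal P_n$, let $a^\vee$ be $a$ with each $x'$ renamed $x''$ and $b^\wedge$ be $b$ with each $x$ renamed $x''$; the product graph $\Pi(a,b)$ on $\mathbf n\cup\mathbf n''\cup\mathbf n'$ has as edges the union of the edges of $a^\vee$ and $b^\wedge$. The product $ab\in\mathcal P_n$ is the partition in which $x,y\in\mathbf n\cup\mathbf n'$ are in the same block iff they are in the same connected component of $\Pi(a,b)$. The identity $1$ of $\mathcal P_n$ has blocks $\{x,x'\}$, $x\in\mathbf n$. The canonical twisting is $\Phi(a,b)$ = the number of floating components of $\Pi(a,b)$, i.e. connected components contained in $\mathbf n''$. $\mathcal S_n\subseteq\mathcal P_n$ is the group of units (partitions all of whose blocks have the form $\{x,y'\}$), and $\operatorname{Sing}(\mathcal P_n)=\mathcal P_n\setminus\mathcal S_n$. $\mathbb Z\times_\Phi^1\mathcal P_n$ is the monoid with underlying set $\mathbb Z\times\mathcal P_n$ and product $(i,a)(j,b)=(i+j+\Phi(a,b),ab)$,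 with identity $(0,1)$. $E(X)$ is the set of idempotents of $X$, and $\langle E(X)\rangle$ the submonoid generated by it. *)

theory Defs
  imports "HOL-Algebra.Group" "HOL-Library.Disjoint_Sets" HOL.Hull
begin

section \<open>Vertices and graphs\<close>

text \<open>\<open>Top x\<close>, \<open>Mid x\<close> and \<open>Bot x\<close> stand for \<open>x\<close>, \<open>x''\<close> and \<open>x'\<close>.\<close>

datatype vertex = Top nat | Mid nat | Bot nat

definition outer_vertices :: "nat \<Rightarrow> vertex set" where
  "outer_vertices n = Top ` {1..n} \<union> Bot ` {1..n}"

definition middle_vertices :: "nat \<Rightarrow> vertex set" where
  "middle_vertices n = Mid ` {1..n}"

text \<open>A partition is represented by the graph joining any two vertices of a common block.
  The loops do not affect connected components.\<close>

definition block_edges :: "'a set set \<Rightarrow> 'a rel" where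
  "block_edges P = (\<Union>B\<in>P. B \<times> B)"

definition graph_components :: "'a set \<Rightarrow> 'a rel \<Rightarrow> 'a set set" where
  "graph_components V E = V // ((E \<union> E\<inverse>)\<^sup>* \<inter> V \<times> V)"

section \<open>The partition monoid and its canonical twisting\<close>

fun bot_to_mid :: "vertex \<Rightarrow> vertex" where
  "bot_to_mid (Bot x) = Mid x"
| "bot_to_mid (Top x) = Top x"
| "bot_to_mid (Mid x) = Mid x"

fun top_to_mid :: "vertex \<Rightarrow> vertex" where
  "top_to_mid (Top x) = Mid x"
| "top_to_mid (Bot x) = Bot x"
| "top_to_mid (Mid x) = Mid x"

definition product_graph_edges :: "vertex set set \<Rightarrow> vertex set set \<Rightarrow> vertex rel" where
  "product_graph_edges a b =
     block_edges ((`) bot_to_mid ` a) \<union> block_edges ((`) top_to_mid ` b)"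

definition product_graph_components ::
    "nat \<Rightarrow> vertex set set \<Rightarrow> vertex set set \<Rightarrow> vertex set set" where
  "product_graph_components n a b =
     graph_components (outer_vertices n \<union> middle_vertices n) (product_graph_edges a b)"

definition partition_mult ::
    "nat \<Rightarrow> vertex set set \<Rightarrow> vertex set set \<Rightarrow> vertex set set" where
  "partition_mult n a b =
     outer_vertices n // {(x, y). x \<in> outer_vertices n \<and> y \<in> outer_vertices n \<and>
       (\<exists>C \<in> product_graph_components n a b. x \<in> C \<and> y \<in> C)}"

definition partition_monoid :: "nat \<Rightarrow> vertex set set monoid" where
  "partition_monoid n =
     \<lparr>carrier = {a. partition_on (outer_vertices n) a},
      mult = partition_mult n,
      one = (\<lambda>x. {Top x, Bot x}) ` {1..n}\<rparr>"

definition canonical_twisting :: "nat \<Rightarrow> vertex set set \<Rightarrow> vertex set set \<Rightarrow> nat" where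
  "canonical_twisting n a b =
     card {C \<in> product_graph_components n a b. C \<subseteq> middle_vertices n}"

definition Sing :: "nat \<Rightarrow> vertex set set set" where
  "Sing n = carrier (partition_monoid n) - Units (partition_monoid n)"

section \<open>Twisted products, idempotents, generated submonoids\<close>

definition twisted_product ::
    "('a, 'm) monoid_scheme \<Rightarrow> ('a \<Rightarrow> 'a \<Rightarrow> nat) \<Rightarrow> (int \<times> 'a) monoid" where
  "twisted_product M \<Phi> =
     \<lparr>carrier = UNIV \<times> carrier M,
      mult = (\<lambda>(i, a) (j, b). (i + j + int (\<Phi> a b), a \<otimes>\<^bsub>M\<^esub> b)),
      one = (0, \<one>\<^bsub>M\<^esub>)\<rparr>"

definition idempotents :: "('a, 'm) monoid_scheme \<Rightarrow> 'a set" where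
  "idempotents M = {x \<in> carrier M. x \<otimes>\<^bsub>M\<^esub> x = x}"

definition generated_submonoid :: "('a, 'm) monoid_scheme \<Rightarrow> 'a set \<Rightarrow> 'a set" where
  "generated_submonoid M X = (\<lambda>H. submonoid H M) hull X"

end

theory Submission
  imports Defs
begin

text \<open>Since \<open>Sing(P_n)\<close> is an ideal and the only idempotent unit is \<open>1\<close>, the right-hand side is a
  submonoid containing all idempotents \<open>(-\<Phi>(e,e), e)\<close>.

  Conversely, products of the small idempotents on two strands \<open>i, j\<close> give \<open>(1, t)\<close> and
  \<open>(-1, t)\<close> for the idempotent \<open>t\<close> merging \<open>i, j, i', j'\<close>, hence \<open>(k, f)\<close> for every integer \<open>k\<close>, where \<open>f\<close>
  is the transformation \<open>j \<mapsto> i\<close>. An element one of whose factors occurs with every counter occurs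
  with every counter itself, so the counter can be ignored from there on.

  Let \<open>a\<close> be singular with transversal blocks \<open>T\<close>, so \<open>|T| < n\<close>. Choose an upper vertex \<open>x k\<close>
  and a lower vertex \<open>y k\<close> in each \<open>k \<in> T\<close>. The diagram with the upper half of \<open>a\<close> and single lower
  endpoints \<open>x k\<close> is idempotent and absorbs some \<open>f\<close> on the right. As there is a free lower vertex,
  multiplying by transformations \<open>p \<mapsto> q\<close> slides the endpoints from \<open>x\<close> to \<open>y\<close>, and a final
  idempotent carrying the lower half of \<open>a\<close> yields \<open>a\<close>.\<close>

section \<open>Labelled partitions and their products\<close>

text \<open>Labels for components of product graphs: \<open>Vertex v\<close> names a component after
  a position \<open>v\<close>, while the other constructors give disjoint copies of old labels, for
  nontransversal upper blocks, floating components and nontransversal lower blocks.\<close>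

datatype 'k label = Vertex nat | Upper 'k | Middle 'k | Lower 'k

text \<open>Encodes a partition by labels: a label taken by both \<open>s\<close> and
  \<open>t\<close> belongs to a transversal block. The value \<open>undefined\<close> stands at
  middle vertices, which are not outer.\<close>

definition fibers :: "nat \<Rightarrow> (nat \<Rightarrow> 'a) \<Rightarrow> (nat \<Rightarrow> 'a) \<Rightarrow> vertex set set" where
  "fibers n s t =
     (\<lambda>u. {v \<in> outer_vertices n. case_vertex s undefined t v = case_vertex s undefined t u})
       ` outer_vertices n"

lemma mem_vertices [simp]:
  "Top v \<in> outer_vertices n \<longleftrightarrow> v \<in> {1..n}" "Bot v \<in> outer_vertices n \<longleftrightarrow> v \<in> {1..n}"
  "Mid v \<notin> outer_vertices n" "Mid v \<in> middle_vertices n \<longleftrightarrow> v \<in> {1..n}"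
  "Top v \<notin> middle_vertices n" "Bot v \<notin> middle_vertices n"
  by (auto simp: outer_vertices_def middle_vertices_def)

lemma outer_vertexE:
  assumes "u \<in> outer_vertices n"
  obtains v where "u = Top v" "v \<in> {1..n}" | v where "u = Bot v" "v \<in> {1..n}"
  using assms by (auto simp: outer_vertices_def)

lemma fibers_eqI:
  assumes "\<And>u v. u \<in> {1..n} \<Longrightarrow> v \<in> {1..n} \<Longrightarrow> s u = s v \<longleftrightarrow> s' u = s' v"
    and "\<And>u v. u \<in> {1..n} \<Longrightarrow> v \<in> {1..n} \<Longrightarrow> s u = t v \<longleftrightarrow> s' u = t' v"
    and "\<And>u v. u \<in> {1..n} \<Longrightarrow> v \<in> {1..n} \<Longrightarrow> t u = t v \<longleftrightarrow> t' u = t' v"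
  shows "fibers n s t = fibers n s' t'"
proof -
  have "case_vertex s undefined t v = case_vertex s undefined t u \<longleftrightarrow>
      case_vertex s' undefined t' v = case_vertex s' undefined t' u"
    if "u \<in> outer_vertices n" "v \<in> outer_vertices n" for u v
    using that assms by (elim outer_vertexE) (simp_all, metis+)
  then show ?thesis
    unfolding fibers_def by (intro image_cong) auto
qed

lemma partition_on_fibers: "partition_on (outer_vertices n) (fibers n s t)"
  unfolding fibers_def by (rule partition_onI) (auto simp: disjnt_def)

lemma same_fiber_iff:
  assumes "u \<in> outer_vertices n" "v \<in> outer_vertices n"
  shows "(\<exists>B\<in>fibers n s t. u \<in> B \<and> v \<in> B) \<longleftrightarrow>
    case_vertex s undefined t u = case_vertex s undefined t v"
  using assms unfolding fibers_def by auto

text \<open>Label every vertex by the block that contains it.\<close>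

lemma partition_eq_fibers:
  assumes "partition_on (outer_vertices n) a"
  obtains s t :: "nat \<Rightarrow> vertex set" where "a = fibers n s t"
proof -
  define bl where "bl u = (THE B. B \<in> a \<and> u \<in> B)" for u
  have bl: "bl u = B" if "B \<in> a" "u \<in> B" for u B
    unfolding bl_def using that assms
    by (intro the_equality) (auto simp: partition_on_def disjoint_def)
  have ex: "\<exists>B\<in>a. u \<in> B" if "u \<in> outer_vertices n" for u
    using that assms by (auto simp: partition_on_def)
  have sub: "B \<subseteq> outer_vertices n" "B \<noteq> {}" if "B \<in> a" for B
    using that assms by (auto simp: partition_on_def)
  define c where "c = case_vertex (\<lambda>v. bl (Top v)) undefined (\<lambda>v. bl (Bot v))"
  have c: "c u = bl u" if "u \<in> outer_vertices n" for u
    using that by (auto elim!: outer_vertexE simp: c_def)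
  have fib: "{v \<in> outer_vertices n. c v = c u} = bl u \<and> bl u \<in> a"
    if u: "u \<in> outer_vertices n" for u
  proof -
    obtain B where B: "B \<in> a" "u \<in> B" using ex[OF u] by blast
    have "v \<in> B \<longleftrightarrow> bl v = B" if "v \<in> outer_vertices n" for v
      using ex[OF that] bl B by metis
    then show ?thesis using bl[OF B] B sub[OF B(1)] c u by auto
  qed
  have "fibers n (\<lambda>v. bl (Top v)) (\<lambda>v. bl (Bot v)) = bl ` outer_vertices n"
    unfolding fibers_def c_def[symmetric] using fib by (intro image_cong) auto
  also have "\<dots> = a"
  proof
    show "bl ` outer_vertices n \<subseteq> a" using fib by auto
    show "a \<subseteq> bl ` outer_vertices n"
    proof
      fix B assume B: "B \<in> a"
      then obtain u where "u \<in> B" using sub by blast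
      then show "B \<in> bl ` outer_vertices n"
        using bl[OF B] sub(1)[OF B] by (metis imageI subsetD)
    qed
  qed
  finally show ?thesis by (metis that)
qed

lemma block_edges_image_fibers:
  "block_edges ((`) f ` fibers n s t) =
     {(p, q). \<exists>u\<in>outer_vertices n. \<exists>v\<in>outer_vertices n. p = f u \<and> q = f v \<and>
        case_vertex s undefined t u = case_vertex s undefined t v}"
  unfolding block_edges_def fibers_def by (fastforce simp: image_iff)

lemma product_graph_edges_fibers:
  "product_graph_edges (fibers n s0 t0) (fibers n s1 t1) =
     {(p, q). \<exists>u\<in>outer_vertices n. \<exists>v\<in>outer_vertices n. p = bot_to_mid u \<and> q = bot_to_mid v \<and>
        case_vertex s0 undefined t0 u = case_vertex s0 undefined t0 v} \<union>
     {(p, q). \<exists>u\<in>outer_vertices n. \<exists>v\<in>outer_vertices n. p = top_to_mid u \<and> q = top_to_mid v \<and>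
        case_vertex s1 undefined t1 u = case_vertex s1 undefined t1 v}"
  unfolding product_graph_edges_def block_edges_image_fibers ..

text \<open>Fixes the numbering by which later proofs cite edges: 1 to 3 come from the first factor,
  4 to 7 from the second.\<close>

lemma product_edgeI:
  fixes n :: nat and s0 t0 :: "nat \<Rightarrow> 'a" and s1 t1 :: "nat \<Rightarrow> 'b"
  defines "E \<equiv> product_graph_edges (fibers n s0 t0) (fibers n s1 t1)"
  assumes "u \<in> {1..n}" "v \<in> {1..n}"
  shows "s0 u = s0 v \<Longrightarrow> (Top u, Top v) \<in> E"
    and "s0 u = t0 v \<Longrightarrow> (Top u, Mid v) \<in> E"
    and "t0 u = t0 v \<Longrightarrow> (Mid u, Mid v) \<in> E"
    and "s1 u = s1 v \<Longrightarrow> (Mid u, Mid v) \<in> E"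
    and "s1 u = t1 v \<Longrightarrow> (Mid u, Bot v) \<in> E"
    and "t1 u = s1 v \<Longrightarrow> (Bot u, Mid v) \<in> E"
    and "t1 u = t1 v \<Longrightarrow> (Bot u, Bot v) \<in> E"
proof -
  have 0: "(bot_to_mid p, bot_to_mid q) \<in> E"
    if "p \<in> outer_vertices n" "q \<in> outer_vertices n"
      "case_vertex s0 undefined t0 p = case_vertex s0 undefined t0 q" for p q
    unfolding E_def product_graph_edges_fibers using that by blast
  have 1: "(top_to_mid p, top_to_mid q) \<in> E"
    if "p \<in> outer_vertices n" "q \<in> outer_vertices n"
      "case_vertex s1 undefined t1 p = case_vertex s1 undefined t1 q" for p q
    unfolding E_def product_graph_edges_fibers using that by blast
  show "s0 u = s0 v \<Longrightarrow> (Top u, Top v) \<in> E" using 0[of "Top u" "Top v"] assms by simp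
  show "s0 u = t0 v \<Longrightarrow> (Top u, Mid v) \<in> E" using 0[of "Top u" "Bot v"] assms by simp
  show "t0 u = t0 v \<Longrightarrow> (Mid u, Mid v) \<in> E" using 0[of "Bot u" "Bot v"] assms by simp
  show "s1 u = s1 v \<Longrightarrow> (Mid u, Mid v) \<in> E" using 1[of "Top u" "Top v"] assms by simp
  show "s1 u = t1 v \<Longrightarrow> (Mid u, Bot v) \<in> E" using 1[of "Top u" "Bot v"] assms by simp
  show "t1 u = s1 v \<Longrightarrow> (Bot u, Mid v) \<in> E" using 1[of "Bot u" "Top v"] assms by simp
  show "t1 u = t1 v \<Longrightarrow> (Bot u, Bot v) \<in> E" using 1[of "Bot u" "Bot v"] assms by simp
qed

section \<open>Connected components of the product graph\<close>

lemma sym_product_graph_edges: "sym (product_graph_edges a b)"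
  unfolding product_graph_edges_def block_edges_def by (rule symI) auto

lemma graph_components_sym:
  assumes "sym E"
  shows "graph_components V E = V // (E\<^sup>* \<inter> V \<times> V)"
  using assms by (simp add: graph_components_def sym_conv_converse_eq)

text \<open>Edges are symmetric, so reachability is an equivalence, and sharing a component means
  being joined by a path, possibly through middle vertices.\<close>

lemma partition_mult_eq_quotient:
  fixes n a b
  defines "R \<equiv> (product_graph_edges a b)\<^sup>* \<inter> outer_vertices n \<times> outer_vertices n"
  shows "partition_mult n a b = outer_vertices n // R" "equiv (outer_vertices n) R"
proof -
  let ?E = "product_graph_edges a b" and ?V = "outer_vertices n \<union> middle_vertices n"
  have symE: "sym (?E\<^sup>*)" by (simp add: sym_product_graph_edges sym_rtrancl)
  have eqv: "equiv A (?E\<^sup>* \<inter> A \<times> A)" for A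
    using symE by (auto intro!: equivI refl_onI symI transI dest: symD rtrancl_trans)
  then show "equiv (outer_vertices n) R" unfolding R_def .
  have "(\<exists>C \<in> product_graph_components n a b. x \<in> C \<and> y \<in> C) \<longleftrightarrow> (x, y) \<in> ?E\<^sup>*"
    if "x \<in> outer_vertices n" "y \<in> outer_vertices n" for x y
    unfolding product_graph_components_def graph_components_sym[OF sym_product_graph_edges]
    using that symE
    by (auto simp: quotient_def Image_iff dest: symD rtrancl_trans)
  then show "partition_mult n a b = outer_vertices n // R"
    unfolding partition_mult_def R_def by (intro arg_cong2[of _ _ _ _ quotient]) auto
qed

lemma partition_on_partition_mult: "partition_on (outer_vertices n) (partition_mult n a b)"
  using partition_mult_eq_quotient partition_on_quotient by metis

text \<open>Serves to deduce paths in the product graph from a product that is already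
  known.\<close>

lemma partition_mult_eq_fibersD:
  assumes "partition_mult n a b = fibers n s t"
    and "u \<in> outer_vertices n" "v \<in> outer_vertices n"
  shows "case_vertex s undefined t u = case_vertex s undefined t v \<longleftrightarrow>
    (u, v) \<in> (product_graph_edges a b)\<^sup>*"
proof -
  let ?R = "(product_graph_edges a b)\<^sup>* \<inter> outer_vertices n \<times> outer_vertices n"
  have "(\<exists>B \<in> outer_vertices n // ?R. u \<in> B \<and> v \<in> B) \<longleftrightarrow> (u, v) \<in> ?R"
    using partition_mult_eq_quotient(2)[of n a b] assms(2,3)
    by (auto simp: quotient_def Image_iff equiv_def dest: symD transD)
  then show ?thesis
    using same_fiber_iff[OF assms(2,3), of s t] assms
      partition_mult_eq_quotient(1)[of n a b] by simp
qed

text \<open>The labelling \<open>s, m, t\<close> of the product graph has its connected components as fibers as soon as it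
  is constant along edges and every vertex is connected to a vertex \<open>\<rho> l\<close> depending on its
  label \<open>l\<close> only.\<close>

lemma fibers_product:
  fixes n :: nat and s0 t0 :: "nat \<Rightarrow> 'a" and s1 t1 :: "nat \<Rightarrow> 'b" and s m t :: "nat \<Rightarrow> 'c"
  defines "E \<equiv> product_graph_edges (fibers n s0 t0) (fibers n s1 t1)"
  assumes compat0: "\<And>u v. u \<in> {1..n} \<Longrightarrow> v \<in> {1..n} \<Longrightarrow>
        (s0 u = s0 v \<longrightarrow> s u = s v) \<and> (s0 u = t0 v \<longrightarrow> s u = m v) \<and> (t0 u = t0 v \<longrightarrow> m u = m v)"
    and compat1: "\<And>u v. u \<in> {1..n} \<Longrightarrow> v \<in> {1..n} \<Longrightarrow>
        (s1 u = s1 v \<longrightarrow> m u = m v) \<and> (s1 u = t1 v \<longrightarrow> m u = t v) \<and> (t1 u = t1 v \<longrightarrow> t u = t v)"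
    and top: "\<And>u. u \<in> {1..n} \<Longrightarrow> (Top u, \<rho> (s u)) \<in> E\<^sup>*"
    and mid: "\<And>u. u \<in> {1..n} \<Longrightarrow> (Mid u, \<rho> (m u)) \<in> E\<^sup>*"
    and bot: "\<And>u. u \<in> {1..n} \<Longrightarrow> (Bot u, \<rho> (t u)) \<in> E\<^sup>*"
    and float: "card (m ` {1..n} - (s ` {1..n} \<union> t ` {1..n})) = k"
  shows "partition_mult n (fibers n s0 t0) (fibers n s1 t1) = fibers n s t \<and>
    canonical_twisting n (fibers n s0 t0) (fibers n s1 t1) = k"
proof (rule conjI)
  let ?V = "outer_vertices n \<union> middle_vertices n"
  define c where "c = case_vertex s m t"
  have "c (bot_to_mid u) = c (bot_to_mid v)"
    if "u \<in> outer_vertices n" "v \<in> outer_vertices n"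
      "case_vertex s0 undefined t0 u = case_vertex s0 undefined t0 v" for u v
  proof -
    note compat = conjunct1[OF compat0, rule_format]
      conjunct1[OF conjunct2[OF compat0], rule_format]
      conjunct2[OF conjunct2[OF compat0], rule_format]
    show ?thesis
      using that unfolding c_def
      by (elim outer_vertexE; simp only: vertex.case bot_to_mid.simps top_to_mid.simps)
        (metis compat)+
  qed
  moreover have "c (top_to_mid u) = c (top_to_mid v)"
    if "u \<in> outer_vertices n" "v \<in> outer_vertices n"
      "case_vertex s1 undefined t1 u = case_vertex s1 undefined t1 v" for u v
  proof -
    note compat = conjunct1[OF compat1, rule_format]
      conjunct1[OF conjunct2[OF compat1], rule_format]
      conjunct2[OF conjunct2[OF compat1], rule_format]
    show ?thesis
      using that unfolding c_def
      by (elim outer_vertexE; simp only: vertex.case bot_to_mid.simps top_to_mid.simps)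
        (metis compat)+
  qed
  ultimately have edge: "c p = c q" if "(p, q) \<in> E" for p q
    using that unfolding E_def product_graph_edges_fibers by blast
  have same: "c p = c q" if "(p, q) \<in> E\<^sup>*" for p q
    using that by (induction rule: rtrancl_induct) (auto dest: edge)
  have to_rep: "(u, \<rho> (c u)) \<in> E\<^sup>*" if "u \<in> ?V" for u
    using that top mid bot by (cases u) (simp_all add: c_def del: atLeastAtMost_iff)
  have "sym (E\<^sup>*)" by (simp add: E_def sym_product_graph_edges sym_rtrancl)
  \<comment> \<open>Constancy along edges keeps different labels apart; equal labels lead to the
    same vertex \<open>\<rho> l\<close>, which joins them.\<close>
  then have conn: "(u, v) \<in> E\<^sup>* \<longleftrightarrow> c u = c v" if "u \<in> ?V" "v \<in> ?V" for u v
    using same[of u v] to_rep[OF that(1)] to_rep[OF that(2)]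
    by (metis rtrancl_trans symD)
  have comp: "product_graph_components n (fibers n s0 t0) (fibers n s1 t1) =
      (\<lambda>u. {v \<in> ?V. c v = c u}) ` ?V"
    unfolding product_graph_components_def graph_components_sym[OF sym_product_graph_edges]
    unfolding E_def[symmetric] quotient_def UNION_singleton_eq_range
    using conn by (intro image_cong) auto
  have outer_c: "c u = case_vertex s undefined t u" if "u \<in> outer_vertices n" for u
    using that by (auto simp: c_def elim: outer_vertexE)
  show "partition_mult n (fibers n s0 t0) (fibers n s1 t1) = fibers n s t"
    unfolding partition_mult_eq_quotient(1)
    unfolding E_def[symmetric] quotient_def UNION_singleton_eq_range fibers_def[of n s t]
    using conn outer_c by (intro image_cong) auto
  let ?F = "\<lambda>l. {v \<in> ?V. c v = l}"
  have mid: "c ` middle_vertices n = m ` {1..n}"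
    by (force simp: c_def middle_vertices_def)
  have out: "c ` outer_vertices n = s ` {1..n} \<union> t ` {1..n}"
    by (force simp: c_def outer_vertices_def)
  have "outer_vertices n \<inter> middle_vertices n = {}"
    by (auto simp: middle_vertices_def)
  \<comment> \<open>A component floats iff no outer vertex carries its label. As \<open>?F\<close>
    is injective on the labels in use, counting these labels counts the floating components.\<close>
  then have "?F l \<subseteq> middle_vertices n \<longleftrightarrow> l \<notin> c ` outer_vertices n" for l
    by blast
  then have "{C \<in> ?F ` c ` ?V. C \<subseteq> middle_vertices n} =
      ?F ` (c ` middle_vertices n - c ` outer_vertices n)"
    by blast
  moreover have "inj_on ?F (c ` middle_vertices n - c ` outer_vertices n)"
    by (rule inj_onI) auto
  ultimately have "card {C \<in> ?F ` c ` ?V. C \<subseteq> middle_vertices n} =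
      card (c ` middle_vertices n - c ` outer_vertices n)"
    by (simp only: card_image)
  then show "canonical_twisting n (fibers n s0 t0) (fibers n s1 t1) = k"
    unfolding canonical_twisting_def comp float[symmetric] mid[symmetric] out[symmetric]
    by (simp only: image_image)
qed

section \<open>Diagrams with trivial upper or lower half\<close>

text \<open>\<open>\<kappa>\<close> labels the upper blocks, \<open>T\<close> is the set of labels of transversal blocks, and the block
  labelled \<open>k \<in> T\<close> has \<open>x k\<close> as its only lower vertex (for \<open>x\<close> injective on \<open>T\<close>); all other lower
  vertices are singleton blocks.\<close>

definition upper_diagram ::
    "nat \<Rightarrow> 'k set \<Rightarrow> (nat \<Rightarrow> 'k) \<Rightarrow> ('k \<Rightarrow> nat) \<Rightarrow> vertex set set" where
  "upper_diagram n T \<kappa> x =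
     fibers n (\<lambda>v. if \<kappa> v \<in> T then Vertex (x (\<kappa> v)) else Upper (\<kappa> v)) Vertex"

text \<open>The reflection of \<open>upper_diagram\<close>: \<open>\<kappa>\<close> now labels lower
  blocks, and \<open>y k\<close> is the only upper vertex of the transversal block
  \<open>k\<close>.\<close>

definition lower_diagram ::
    "nat \<Rightarrow> 'k set \<Rightarrow> (nat \<Rightarrow> 'k) \<Rightarrow> ('k \<Rightarrow> nat) \<Rightarrow> vertex set set" where
  "lower_diagram n T \<kappa> y =
     fibers n Vertex (\<lambda>v. if \<kappa> v \<in> T then Vertex (y (\<kappa> v)) else Lower (\<kappa> v))"

text \<open>The usual embedding of transformations into partitions: for \<open>f\<close> mapping
  into \<open>{1..n}\<close>, the block of \<open>q'\<close> consists of \<open>q'\<close> and the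
  preimage of \<open>q\<close>. With all labels transversal, \<open>Upper\<close> does not
  occur.\<close>

definition transformation :: "nat \<Rightarrow> (nat \<Rightarrow> nat) \<Rightarrow> vertex set set" where
  "transformation n f = upper_diagram n UNIV (\<lambda>v. v) f"

lemma upper_diagram_cong:
  assumes "\<And>k. k \<in> T \<Longrightarrow> x k = x' k"
  shows "upper_diagram n T \<kappa> x = upper_diagram n T \<kappa> x'"
  using assms by (simp add: upper_diagram_def cong: if_cong)

lemma transformation_cong:
  assumes "\<And>v. v \<in> {1..n} \<Longrightarrow> f v = f' v"
  shows "transformation n f = transformation n f'"
  unfolding transformation_def upper_diagram_def
  by (rule fibers_eqI) (use assms in simp_all)

lemma transformation_id: "transformation n (\<lambda>v. v) = (\<lambda>x. {Top x, Bot x}) ` {1..n}"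
proof -
  have *: "{u \<in> outer_vertices n. case_vertex Vertex undefined Vertex u = (Vertex v :: nat label)} =
      {Top v, Bot v}" if "v \<in> {1..n}" for v
    using that by (auto elim!: outer_vertexE)
  have "transformation n (\<lambda>v. v) = fibers n Vertex (Vertex :: nat \<Rightarrow> nat label)"
    by (simp add: transformation_def upper_diagram_def)
  also have "\<dots> = (\<lambda>v. {u \<in> outer_vertices n.
      case_vertex Vertex undefined Vertex u = (Vertex v :: nat label)}) ` {1..n}"
    unfolding fibers_def
    by (subst (2) outer_vertices_def) (simp only: image_Un image_image vertex.case Un_absorb)
  finally show ?thesis using * by auto
qed

text \<open>Supplies the vertices \<open>\<rho> l\<close> for \<open>fibers_product\<close>, and
  later the chosen upper and lower vertices of transversal blocks.\<close>

definition representative :: "nat \<Rightarrow> (nat \<Rightarrow> 'k) \<Rightarrow> 'k \<Rightarrow> nat" where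
  "representative n \<kappa> k = (SOME v. v \<in> {1..n} \<and> \<kappa> v = k)"

lemma representative:
  assumes "k \<in> \<kappa> ` {1..n}"
  shows "representative n \<kappa> k \<in> {1..n}" "\<kappa> (representative n \<kappa> k) = k"
proof -
  have "\<exists>v. v \<in> {1..n} \<and> \<kappa> v = k" using assms by blast
  from someI_ex[OF this] show "representative n \<kappa> k \<in> {1..n}" "\<kappa> (representative n \<kappa> k) = k"
    unfolding representative_def by blast+
qed

text \<open>In the product graph the block \<open>k\<close> reaches the middle vertex
  \<open>x k\<close> and from there the lower vertex \<open>f (x k)\<close>. Each middle vertex is
  joined to a lower one, so nothing floats.\<close>

lemma upper_diagram_transformation:
  assumes x: "\<And>v. v \<in> {1..n} \<Longrightarrow> \<kappa> v \<in> T \<Longrightarrow> x (\<kappa> v) \<in> {1..n}"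
    and f: "\<And>v. v \<in> {1..n} \<Longrightarrow> f v \<in> {1..n}"
  shows "partition_mult n (upper_diagram n T \<kappa> x) (transformation n f) =
      upper_diagram n T \<kappa> (\<lambda>k. f (x k)) \<and>
    canonical_twisting n (upper_diagram n T \<kappa> x) (transformation n f) = 0"
  unfolding transformation_def upper_diagram_def
proof (rule fibers_product[where m = "\<lambda>v. Vertex (f v)"
    and \<rho> = "case_label Bot (\<lambda>k. Top (representative n \<kappa> k)) undefined undefined"],
    goal_cases compat0 compat1 top mid bot float)
  case (top u)
  show ?case
  proof (cases "\<kappa> u \<in> T")
    case True
    then show ?thesis
      using x[OF top] f[OF x[OF top]] top
      by (auto intro!: converse_rtrancl_into_rtrancl[OF product_edgeI(2)[where v = "x (\<kappa> u)"]]
        r_into_rtrancl[OF product_edgeI(5)])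
  next
    case False
    then show ?thesis
      using representative[of "\<kappa> u" \<kappa> n] top
      by (auto intro!: r_into_rtrancl[OF product_edgeI(1)])
  qed
next
  case (mid u)
  then show ?case using f[OF mid] by (auto intro!: r_into_rtrancl[OF product_edgeI(5)])
next
  case float
  then show ?case using f by (auto simp: card_eq_0_iff)
qed (auto split: if_splits)

lemma transformation_mult:
  assumes "\<And>v. v \<in> {1..n} \<Longrightarrow> f v \<in> {1..n}" "\<And>v. v \<in> {1..n} \<Longrightarrow> g v \<in> {1..n}"
  shows "partition_mult n (transformation n f) (transformation n g) =
      transformation n (\<lambda>v. g (f v)) \<and>
    canonical_twisting n (transformation n f) (transformation n g) = 0"
  using upper_diagram_transformation[of n "\<lambda>v. v" UNIV f g] assms
  unfolding transformation_def by simp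

text \<open>The endpoint \<open>x k\<close> lies in the upper block \<open>k\<close> itself, so the
  first copy hands block \<open>k\<close> over to block \<open>k\<close> of the second copy, which
  ends at \<open>x k\<close> again.\<close>

lemma upper_diagram_idempotent:
  assumes x: "\<And>k. k \<in> T \<Longrightarrow> x k \<in> {1..n} \<and> \<kappa> (x k) = k"
  shows "partition_mult n (upper_diagram n T \<kappa> x) (upper_diagram n T \<kappa> x) =
    upper_diagram n T \<kappa> x"
  unfolding upper_diagram_def
\<comment> \<open>The label \<open>Vertex v\<close> is represented by \<open>Mid v\<close> if
  \<open>v\<close> is an endpoint, and otherwise by the isolated \<open>Bot v\<close>. As
  \<open>conjunct1\<close> drops the twisting, the number of floating components stays a schematic
  unknown and its goal holds by reflexivity.\<close>
proof (rule conjunct1[OF fibers_product[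
    where m = "\<lambda>v. if \<kappa> v \<in> T then Vertex (x (\<kappa> v)) else Middle (\<kappa> v)"
    and \<rho> = "case_label (\<lambda>v. if \<kappa> v \<in> T \<and> x (\<kappa> v) = v then Mid v else Bot v)
      (\<lambda>k. Top (representative n \<kappa> k)) (\<lambda>k. Mid (representative n \<kappa> k)) undefined"]],
    goal_cases compat0 compat1 top mid bot float)
  case (top u)
  then show ?case
    using representative[of "\<kappa> u" \<kappa> n] x[of "\<kappa> u"]
    by (auto intro!: r_into_rtrancl[OF product_edgeI(1)] r_into_rtrancl[OF product_edgeI(2)])
next
  case (mid u)
  then show ?case
    using representative[of "\<kappa> u" \<kappa> n] x[of "\<kappa> u"]
    by (auto intro!: r_into_rtrancl[OF product_edgeI(4)])
next
  case (bot u)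
  then show ?case by (auto intro!: r_into_rtrancl[OF product_edgeI(6)])
next
  case (compat0 u v)
  then show ?case using x by (auto split: if_splits)
next
  case (compat1 u v)
  then show ?case using x by (auto split: if_splits; metis)
qed simp

text \<open>The argument for \<open>upper_diagram_idempotent\<close>, upside down.\<close>

lemma lower_diagram_idempotent:
  assumes y: "\<And>k. k \<in> T \<Longrightarrow> y k \<in> {1..n} \<and> \<kappa> (y k) = k"
  shows "partition_mult n (lower_diagram n T \<kappa> y) (lower_diagram n T \<kappa> y) =
    lower_diagram n T \<kappa> y"
  unfolding lower_diagram_def
proof (rule conjunct1[OF fibers_product[
    where m = "\<lambda>v. if \<kappa> v \<in> T then Vertex (y (\<kappa> v)) else Middle (\<kappa> v)"
    and \<rho> = "case_label (\<lambda>v. if \<kappa> v \<in> T \<and> y (\<kappa> v) = v then Mid v else Top v)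
      undefined (\<lambda>k. Mid (representative n \<kappa> k)) (\<lambda>k. Bot (representative n \<kappa> k))"]],
    goal_cases compat0 compat1 top mid bot float)
  case (top u)
  then show ?case by (auto intro!: r_into_rtrancl[OF product_edgeI(2)])
next
  case (mid u)
  then show ?case
    using representative[of "\<kappa> u" \<kappa> n] y[of "\<kappa> u"]
    by (auto intro!: r_into_rtrancl[OF product_edgeI(3)])
next
  case (bot u)
  then show ?case
    using representative[of "\<kappa> u" \<kappa> n] y[of "\<kappa> u"]
    by (auto intro!: r_into_rtrancl[OF product_edgeI(6)] r_into_rtrancl[OF product_edgeI(7)])
next
  case (compat0 u v)
  then show ?case using y by (auto split: if_splits; metis)
next
  case (compat1 u v)
  then show ?case using y by (auto split: if_splits)
qed simp

text \<open>The two halves are glued at the middle vertices \<open>y k\<close>, one for each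
  transversal block. Since \<open>\<kappa>'\<close> inverts \<open>y\<close> on \<open>T\<close>,
  distinct transversal blocks stay apart.\<close>

lemma fibers_factorization:
  assumes T: "T = \<kappa> ` {1..n} \<inter> \<kappa>' ` {1..n}"
    and y: "\<And>k. k \<in> T \<Longrightarrow> y k \<in> {1..n} \<and> \<kappa>' (y k) = k"
  shows "partition_mult n (upper_diagram n T \<kappa> y) (lower_diagram n T \<kappa>' y) = fibers n \<kappa> \<kappa>'"
proof -
  let ?s = "\<lambda>v. if \<kappa> v \<in> T then Vertex (y (\<kappa> v)) else Upper (\<kappa> v)"
  let ?t = "\<lambda>v. if \<kappa>' v \<in> T then Vertex (y (\<kappa>' v)) else Lower (\<kappa>' v)"
  have "partition_mult n (upper_diagram n T \<kappa> y) (lower_diagram n T \<kappa>' y) = fibers n ?s ?t"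
    unfolding upper_diagram_def lower_diagram_def
  proof (rule conjunct1[OF fibers_product[where m = Vertex
      and \<rho> = "case_label Mid (\<lambda>k. Top (representative n \<kappa> k)) undefined
        (\<lambda>k. Bot (representative n \<kappa>' k))"]], goal_cases compat0 compat1 top mid bot float)
    case (top u)
    then show ?case
      using representative[of "\<kappa> u" \<kappa> n] y[of "\<kappa> u"]
      by (auto intro!: r_into_rtrancl[OF product_edgeI(1)] r_into_rtrancl[OF product_edgeI(2)])
  next
    case (bot u)
    then show ?case
      using representative[of "\<kappa>' u" \<kappa>' n] y[of "\<kappa>' u"]
      by (auto intro!: r_into_rtrancl[OF product_edgeI(6)] r_into_rtrancl[OF product_edgeI(7)])
  qed (auto split: if_splits)
  also have "\<dots> = fibers n \<kappa> \<kappa>'"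
  proof (rule fibers_eqI)
    fix u v assume uv: "u \<in> {1..n}" "v \<in> {1..n}"
    have y_inj: "y k = y l \<longleftrightarrow> k = l" if "k \<in> T" "l \<in> T" for k l
      using y that by metis
    show "?s u = ?s v \<longleftrightarrow> \<kappa> u = \<kappa> v" "?t u = ?t v \<longleftrightarrow> \<kappa>' u = \<kappa>' v"
      using y_inj by auto
    have "\<kappa> u = \<kappa>' v \<Longrightarrow> \<kappa> u \<in> T" using uv T by (metis IntI imageI)
    then show "?s u = ?t v \<longleftrightarrow> \<kappa> u = \<kappa>' v" using y_inj by auto
  qed
  finally show ?thesis .
qed

section \<open>Units\<close>

text \<open>Choosing a lower vertex \<open>\<pi> u\<close> in the block of each \<open>u\<close>
  gives an injection of a finite set into itself, hence a bijection, which leaves no room for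
  further lower vertices in a block.\<close>

lemma fibers_eq_transformation:
  assumes inj: "\<And>u v. u \<in> {1..n} \<Longrightarrow> v \<in> {1..n} \<Longrightarrow> s u = s v \<Longrightarrow> u = v"
    and total: "\<And>u. u \<in> {1..n} \<Longrightarrow> \<exists>w\<in>{1..n}. s u = t w"
  obtains \<pi> where "bij_betw \<pi> {1..n} {1..n}" "fibers n s t = transformation n \<pi>"
proof -
  obtain \<pi> where \<pi>: "\<pi> u \<in> {1..n}" "t (\<pi> u) = s u" if "u \<in> {1..n}" for u
    using total by metis
  have inj_\<pi>: "inj_on \<pi> {1..n}"
    by (rule inj_onI) (metis \<pi>(2) inj)
  then have surj: "\<pi> ` {1..n} = {1..n}"
    using \<pi>(1) by (intro endo_inj_surj) auto
  have t_inj: "w = w'" if w: "w \<in> {1..n}" "w' \<in> {1..n}" "t w = t w'" for w w'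
  proof -
    obtain u u' where "u \<in> {1..n}" "w = \<pi> u" "u' \<in> {1..n}" "w' = \<pi> u'"
      using surj w(1,2) by (metis imageE)
    then show ?thesis using w(3) \<pi>(2) inj by metis
  qed
  have "fibers n s t = transformation n \<pi>"
    unfolding transformation_def upper_diagram_def
  proof (rule fibers_eqI)
    fix u v assume uv: "u \<in> {1..n}" "v \<in> {1..n}"
    show "s u = s v \<longleftrightarrow> (if u \<in> UNIV then Vertex (\<pi> u) else Upper u) =
        (if v \<in> UNIV then Vertex (\<pi> v) else Upper v)"
      using inj[OF uv] inj_onD[OF inj_\<pi> _ uv] by auto
    show "s u = t v \<longleftrightarrow> (if u \<in> UNIV then Vertex (\<pi> u) else Upper u) = Vertex v"
      using uv t_inj \<pi> by (metis UNIV_I label.inject(1))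
    show "t u = t v \<longleftrightarrow> Vertex u = Vertex v"
      using t_inj[OF uv] by auto
  qed
  with surj inj_\<pi> show ?thesis by (intro that[of \<pi>]) (simp_all add: bij_betw_def)
qed

text \<open>Choosing upper vertices for lower ones gives a bijection \<open>\<sigma>\<close>, along
  which both hypotheses carry over to those of \<open>fibers_eq_transformation\<close>.\<close>

lemma fibers_eq_transformation_dual:
  assumes inj: "\<And>u v. u \<in> {1..n} \<Longrightarrow> v \<in> {1..n} \<Longrightarrow> t u = t v \<Longrightarrow> u = v"
    and total: "\<And>w. w \<in> {1..n} \<Longrightarrow> \<exists>u\<in>{1..n}. s u = t w"
  obtains \<pi> where "bij_betw \<pi> {1..n} {1..n}" "fibers n s t = transformation n \<pi>"
proof -
  obtain \<sigma> where \<sigma>: "\<sigma> w \<in> {1..n}" "s (\<sigma> w) = t w" if "w \<in> {1..n}" for w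
    using total by metis
  have "inj_on \<sigma> {1..n}"
    by (rule inj_onI) (metis \<sigma>(2) inj)
  then have "\<sigma> ` {1..n} = {1..n}"
    using \<sigma>(1) by (intro endo_inj_surj) auto
  then have ex: "\<exists>w\<in>{1..n}. u = \<sigma> w" if "u \<in> {1..n}" for u
    using that by (metis imageE)
  show ?thesis
  proof (rule fibers_eq_transformation[of n s t])
    show "u = v" if "u \<in> {1..n}" "v \<in> {1..n}" "s u = s v" for u v
      using ex[OF that(1)] ex[OF that(2)] that(3) \<sigma>(2) inj by metis
    show "\<exists>w\<in>{1..n}. s u = t w" if "u \<in> {1..n}" for u
      using ex[OF that] \<sigma>(2) by metis
  qed (rule that)
qed

lemma rtrancl_closed:
  assumes "(x, y) \<in> E\<^sup>*" "x \<in> X" "\<And>p q. (p, q) \<in> E \<Longrightarrow> p \<in> X \<Longrightarrow> q \<in> X"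
  shows "y \<in> X"
  using assms(1,2) by (induction rule: rtrancl_induct) (auto dest: assms(3))

text \<open>Upper vertices joined in \<open>a\<close> stay joined in the product, so
  \<open>a\<close> separates them as \<open>\<pi>\<close> does; and an upper block of
  \<open>a\<close> without lower vertices could not reach the bottom. For \<open>b\<close> the same
  holds from below.\<close>

lemma factors_of_transformation:
  assumes a: "partition_on (outer_vertices n) a" and b: "partition_on (outer_vertices n) b"
    and \<pi>: "bij_betw \<pi> {1..n} {1..n}" and ab: "partition_mult n a b = transformation n \<pi>"
  shows "\<exists>\<sigma>. bij_betw \<sigma> {1..n} {1..n} \<and> a = transformation n \<sigma>"
    and "\<exists>\<sigma>. bij_betw \<sigma> {1..n} {1..n} \<and> b = transformation n \<sigma>"
proof -
  obtain s0 t0 :: "nat \<Rightarrow> vertex set" where a_eq: "a = fibers n s0 t0"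
    using partition_eq_fibers[OF a] .
  obtain s1 t1 :: "nat \<Rightarrow> vertex set" where b_eq: "b = fibers n s1 t1"
    using partition_eq_fibers[OF b] .
  let ?E = "product_graph_edges (fibers n s0 t0) (fibers n s1 t1)"
  have "partition_mult n a b = fibers n (\<lambda>v. Vertex (\<pi> v)) (Vertex :: nat \<Rightarrow> nat label)"
    by (simp add: ab transformation_def upper_diagram_def)
  note conn = partition_mult_eq_fibersD[OF this, unfolded a_eq b_eq]
  have \<pi>_inj: "u = v" if "u \<in> {1..n}" "v \<in> {1..n}" "\<pi> u = \<pi> v" for u v
    using \<pi> that by (auto simp: bij_betw_def dest: inj_onD)
  have \<pi>_img: "\<pi> ` {1..n} = {1..n}" using \<pi> by (simp add: bij_betw_def)
  show "\<exists>\<sigma>. bij_betw \<sigma> {1..n} {1..n} \<and> a = transformation n \<sigma>"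
  proof (rule fibers_eq_transformation[of n s0 t0])
    fix u v assume uv: "u \<in> {1..n}" "v \<in> {1..n}" "s0 u = s0 v"
    then have "(Top u, Top v) \<in> ?E\<^sup>*"
      by (intro r_into_rtrancl product_edgeI(1))
    then have "\<pi> u = \<pi> v" using conn[of "Top u" "Top v"] uv(1,2) by simp
    then show "u = v" by (rule \<pi>_inj[OF uv(1,2)])
  next
    fix u assume u: "u \<in> {1..n}"
    show "\<exists>w\<in>{1..n}. s0 u = t0 w"
    proof (rule ccontr)
      assume "\<not> ?thesis"
      then have no: "t0 w \<noteq> s0 u" if "w \<in> {1..n}" for w using that by force
      have "\<pi> u \<in> {1..n}" using \<pi>_img u by blast
      then have "(Top u, Bot (\<pi> u)) \<in> ?E\<^sup>*"
        using conn[of "Top u" "Bot (\<pi> u)"] u by simp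
      \<comment> \<open>If the block of \<open>u\<close> had no lower vertex, its upper vertices
        would be closed under all edges, so no path could leave them.\<close>
      then have "Bot (\<pi> u) \<in> {Top v |v. v \<in> {1..n} \<and> s0 v = s0 u}"
      proof (rule rtrancl_closed)
        fix p q assume "(p, q) \<in> ?E" "p \<in> {Top v |v. v \<in> {1..n} \<and> s0 v = s0 u}"
        then show "q \<in> {Top v |v. v \<in> {1..n} \<and> s0 v = s0 u}"
          unfolding product_graph_edges_fibers by (auto simp: no elim!: outer_vertexE)
      qed (use u in auto)
      then show False by simp
    qed
  qed (metis a_eq)
  show "\<exists>\<sigma>. bij_betw \<sigma> {1..n} {1..n} \<and> b = transformation n \<sigma>"
  proof (rule fibers_eq_transformation_dual[of n t1 s1])
    fix u v assume uv: "u \<in> {1..n}" "v \<in> {1..n}" "t1 u = t1 v"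
    then have "(Bot u, Bot v) \<in> ?E\<^sup>*"
      by (intro r_into_rtrancl product_edgeI(7))
    then show "u = v" using conn[of "Bot u" "Bot v"] uv(1,2) by simp
  next
    fix w assume w: "w \<in> {1..n}"
    show "\<exists>u\<in>{1..n}. s1 u = t1 w"
    proof (rule ccontr)
      assume "\<not> ?thesis"
      then have no: "s1 u \<noteq> t1 w" if "u \<in> {1..n}" for u using that by force
      obtain u where u: "u \<in> {1..n}" "w = \<pi> u" using \<pi>_img w by (metis imageE)
      then have "(Bot w, Top u) \<in> ?E\<^sup>*"
        using conn[of "Bot w" "Top u"] w by simp
      then have "Top u \<in> {Bot v |v. v \<in> {1..n} \<and> t1 v = t1 w}"
      proof (rule rtrancl_closed)
        fix p q assume "(p, q) \<in> ?E" "p \<in> {Bot v |v. v \<in> {1..n} \<and> t1 v = t1 w}"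
        then show "q \<in> {Bot v |v. v \<in> {1..n} \<and> t1 v = t1 w}"
          unfolding product_graph_edges_fibers by (auto simp: no elim!: outer_vertexE)
      qed (use w in auto)
      then show False by simp
    qed
  qed (metis b_eq)
qed

text \<open>A unit is a factor of the identity, which is a transformation by a bijection.
  Conversely, the inverse permutation provides the inverse.\<close>

lemma Units_partition_monoid:
  "Units (partition_monoid n) = {transformation n \<pi> |\<pi>. bij_betw \<pi> {1..n} {1..n}}"
proof (intro equalityI subsetI)
  fix a assume "a \<in> Units (partition_monoid n)"
  then obtain b where "partition_on (outer_vertices n) a" "partition_on (outer_vertices n) b"
    "partition_mult n a b = transformation n (\<lambda>v. v)"
    by (auto simp: Units_def partition_monoid_def transformation_id)
  from factors_of_transformation(1)[OF this(1,2) _ this(3)]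
  show "a \<in> {transformation n \<pi> |\<pi>. bij_betw \<pi> {1..n} {1..n}}"
    using bij_betw_id[unfolded id_def] by blast
next
  fix a assume "a \<in> {transformation n \<pi> |\<pi>. bij_betw \<pi> {1..n} {1..n}}"
  then obtain \<pi> where a: "a = transformation n \<pi>" and \<pi>: "bij_betw \<pi> {1..n} {1..n}" by blast
  define \<sigma> where "\<sigma> = inv_into {1..n} \<pi>"
  have \<sigma>: "bij_betw \<sigma> {1..n} {1..n}"
    unfolding \<sigma>_def using \<pi> by (rule bij_betw_inv_into)
  have range: "\<pi> v \<in> {1..n}" "\<sigma> v \<in> {1..n}" if "v \<in> {1..n}" for v
    using that \<pi> \<sigma> by (auto dest: bij_betwE)
  have inv: "\<sigma> (\<pi> v) = v" "\<pi> (\<sigma> v) = v" if "v \<in> {1..n}" for v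
    unfolding \<sigma>_def using that \<pi>
    by (auto simp: bij_betw_inv_into_left bij_betw_inv_into_right)
  have "partition_mult n (transformation n \<pi>) (transformation n \<sigma>) = transformation n (\<lambda>v. v)"
    using transformation_mult[OF range] transformation_cong[OF inv(1)] by simp
  moreover have
    "partition_mult n (transformation n \<sigma>) (transformation n \<pi>) = transformation n (\<lambda>v. v)"
    using transformation_mult[OF range(2,1)] transformation_cong[OF inv(2)] by simp
  moreover have "partition_on (outer_vertices n) (transformation n f)" for f
    unfolding transformation_def upper_diagram_def by (rule partition_on_fibers)
  ultimately show "a \<in> Units (partition_monoid n)"
    unfolding a Units_def partition_monoid_def transformation_id[symmetric]
    by (auto intro!: bexI[of _ "transformation n \<sigma>"])
qed

section \<open>The ideal of singular partitions\<close>

lemma Sing_iff: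
  "a \<in> Sing n \<longleftrightarrow> partition_on (outer_vertices n) a \<and>
     (\<nexists>\<pi>. bij_betw \<pi> {1..n} {1..n} \<and> a = transformation n \<pi>)"
  unfolding Sing_def Units_partition_monoid by (auto simp: partition_monoid_def)

text \<open>Were the product a unit, both factors would be units.\<close>

lemma Sing_ideal:
  assumes "partition_on (outer_vertices n) a" "partition_on (outer_vertices n) b"
    and "a \<in> Sing n \<or> b \<in> Sing n"
  shows "partition_mult n a b \<in> Sing n"
  using assms factors_of_transformation[OF assms(1,2)] partition_on_partition_mult
  unfolding Sing_iff by metis

text \<open>With \<open>n\<close> labels common to both halves, \<open>s\<close> would be injective
  and every upper block would contain a lower vertex, which makes the partition a
  permutation.\<close>

lemma Sing_card_less:
  assumes "fibers n s t \<in> Sing n"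
  shows "card (s ` {1..n} \<inter> t ` {1..n}) < n"
proof (rule ccontr)
  assume "\<not> ?thesis"
  moreover have "card (s ` {1..n}) \<le> n" using card_image_le[of "{1..n}" s] by simp
  moreover have "card (s ` {1..n} \<inter> t ` {1..n}) \<le> card (s ` {1..n})"
    by (intro card_mono) auto
  ultimately have card: "card (s ` {1..n}) = card {1..n}"
    and eq: "s ` {1..n} \<inter> t ` {1..n} = s ` {1..n}"
    by (simp, intro card_subset_eq) auto
  have "inj_on s {1..n}" using card by (intro eq_card_imp_inj_on) auto
  moreover have "\<exists>w\<in>{1..n}. s u = t w" if "u \<in> {1..n}" for u
    using eq that by blast
  ultimately obtain \<pi> where "bij_betw \<pi> {1..n} {1..n}" "fibers n s t = transformation n \<pi>"
    using fibers_eq_transformation[of n s t] by (metis inj_onD)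
  then show False using assms unfolding Sing_iff by blast
qed

section \<open>Moving the counter\<close>

definition merge :: "nat \<Rightarrow> nat \<Rightarrow> nat \<Rightarrow> nat" where
  "merge i j = (\<lambda>v. if v = j then i else v)"

text \<open>The diagrams \<open>e\<close>, \<open>f\<close>, \<open>g\<close>, \<open>t\<close> are the identity away from \<open>i\<close> and \<open>j\<close>, where their blocks are
  \<open>{i, i'}, {j}, {j'}\<close>; \<open>{i, j, i'}, {j'}\<close>; \<open>{i, i', j'}, {j}\<close>; and \<open>{i, j, i', j'}\<close>.\<close>

lemma merge_products:
  fixes n i j :: nat
  defines "e \<equiv> fibers n (Vertex(j := Upper j)) (Vertex(j := Lower j :: nat label))"
    and "f \<equiv> transformation n (merge i j)"
    and "g \<equiv> fibers n Vertex (\<lambda>v. Vertex (merge i j v) :: nat label)"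
    and "t \<equiv> fibers n (\<lambda>v. Vertex (merge i j v)) (\<lambda>v. Vertex (merge i j v) :: nat label)"
  assumes ij: "i \<in> {1..n}" "j \<in> {1..n}" "i \<noteq> j"
  shows "partition_mult n e e = e \<and> canonical_twisting n e e = 1"
    and "partition_mult n f f = f \<and> canonical_twisting n f f = 0"
    and "partition_mult n g g = g \<and> canonical_twisting n g g = 0"
    and "partition_mult n t t = t \<and> canonical_twisting n t t = 0"
    and "partition_mult n t e = f \<and> canonical_twisting n t e = 0"
    and "partition_mult n f t = t \<and> canonical_twisting n f t = 0"
    and "partition_mult n f g = t \<and> canonical_twisting n f g = 1"
proof -
  let ?\<mu> = "merge i j"
  have f: "f = fibers n (\<lambda>v. Vertex (?\<mu> v)) (Vertex :: nat \<Rightarrow> nat label)"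
    by (simp add: f_def transformation_def upper_diagram_def)
  have range: "?\<mu> v \<in> {1..n}" if "v \<in> {1..n}" for v using that ij by (simp add: merge_def)
  have idem: "?\<mu> (?\<mu> v) = ?\<mu> v" for v using ij by (simp add: merge_def)
  have ne: "?\<mu> v \<noteq> j" for v using ij by (simp add: merge_def)
  have fix_ne: "v \<noteq> j \<Longrightarrow> ?\<mu> v = v" for v by (simp add: merge_def)
  note edges = r_into_rtrancl[OF product_edgeI(2)] r_into_rtrancl[OF product_edgeI(3)]
    r_into_rtrancl[OF product_edgeI(4)] r_into_rtrancl[OF product_edgeI(6)]
  show "partition_mult n f f = f \<and> canonical_twisting n f f = 0"
    unfolding f_def using transformation_mult[of n ?\<mu> ?\<mu>, OF range range] by (simp add: idem)
  \<comment> \<open>The middle vertex \<open>j\<close> is isolated in both copies, so it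
    floats.\<close>
  show "partition_mult n e e = e \<and> canonical_twisting n e e = 1"
    unfolding e_def
  proof (rule fibers_product[where m = "Vertex(j := Middle j)"
      and \<rho> = "case_label Mid Top Mid Bot"], goal_cases compat0 compat1 top mid bot float)
    case float
    have "(Vertex(j := Middle j)) ` {1..n} - ((Vertex(j := Upper j)) ` {1..n} \<union>
        (Vertex(j := Lower j)) ` {1..n}) = {Middle j :: nat label}"
      using ij(2) by (auto simp: image_iff)
    then show ?case by simp
  next
    case (bot u)
    then show ?case by (auto intro!: edges(4))
  next
    case (top u)
    then show ?case by (auto intro!: edges(1))
  qed auto
  show "partition_mult n g g = g \<and> canonical_twisting n g g = 0"
    unfolding g_def
  proof (rule fibers_product[where m = "\<lambda>v. Vertex (?\<mu> v)"
      and \<rho> = "case_label (\<lambda>v. if v = j then Top j else Mid v) undefined undefined undefined"],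
      goal_cases compat0 compat1 top mid bot float)
    case (top u)
    then show ?case by (auto intro!: edges(1) simp: fix_ne)
  next
    case (mid u)
    then show ?case using range[OF mid] by (auto intro!: edges(2) simp: ne idem)
  next
    case (bot u)
    then show ?case using range[OF bot] by (auto intro!: edges(4) simp: ne)
  qed (auto simp: idem)
  show "partition_mult n t t = t \<and> canonical_twisting n t t = 0"
    unfolding t_def
  proof (rule fibers_product[where m = "\<lambda>v. Vertex (?\<mu> v)"
      and \<rho> = "case_label Mid undefined undefined undefined"],
      goal_cases compat0 compat1 top mid bot float)
    case (top u)
    then show ?case using range[OF top] by (auto intro!: edges(1) simp: idem)
  next
    case (mid u)
    then show ?case using range[OF mid] by (auto intro!: edges(2) simp: idem)
  next
    case (bot u)
    then show ?case using range[OF bot] by (auto intro!: edges(4) simp: idem)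
  qed auto
  \<comment> \<open>The middle vertex \<open>j\<close> is isolated in \<open>e\<close> but tied to
    \<open>i\<close> by \<open>t\<close>, so nothing floats.\<close>
  show "partition_mult n t e = f \<and> canonical_twisting n t e = 0"
    unfolding t_def e_def f
  proof (rule fibers_product[where m = "\<lambda>v. Vertex (?\<mu> v)"
      and \<rho> = "case_label (\<lambda>v. if v = j then Bot j else Mid v) undefined undefined undefined"],
      goal_cases compat0 compat1 top mid bot float)
    case (top u)
    then show ?case using range[OF top] by (auto intro!: edges(1) simp: idem ne)
  next
    case (mid u)
    then show ?case using range[OF mid] by (auto intro!: edges(2) simp: idem ne)
  next
    case (bot u)
    then show ?case by (auto intro!: edges(4))
  qed (auto simp: fix_ne)
  show "partition_mult n f t = t \<and> canonical_twisting n f t = 0"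
    unfolding t_def f
  proof (rule fibers_product[where m = "\<lambda>v. Vertex (?\<mu> v)"
      and \<rho> = "case_label Mid undefined undefined undefined"],
      goal_cases compat0 compat1 top mid bot float)
    case (top u)
    then show ?case using range[OF top] by (auto intro!: edges(1))
  next
    case (mid u)
    then show ?case using range[OF mid] by (auto intro!: edges(3) simp: idem)
  next
    case (bot u)
    then show ?case using range[OF bot] by (auto intro!: edges(4) simp: idem)
  qed (auto simp: idem)
  \<comment> \<open>Both \<open>j'\<close> in \<open>f\<close> and \<open>j\<close> in
    \<open>g\<close> are singletons, so the middle vertex \<open>j\<close> floats; all else at
    \<open>i\<close> and \<open>j\<close> is joined through the middle vertex
    \<open>i\<close>.\<close>
  show "partition_mult n f g = t \<and> canonical_twisting n f g = 1"
    unfolding t_def f g_def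
  proof (rule fibers_product[where m = "Vertex(j := Middle j)"
      and \<rho> = "case_label Mid undefined Mid undefined"],
      goal_cases compat0 compat1 top mid bot float)
    case (top u)
    then show ?case using range[OF top] by (auto intro!: edges(1))
  next
    case (bot u)
    then show ?case using range[OF bot] by (auto intro!: edges(4))
  next
    case float
    have "Vertex v \<in> (\<lambda>v. Vertex (?\<mu> v) :: nat label) ` {1..n}" if "v \<in> {1..n}" "v \<noteq> j" for v
      using that fix_ne[OF that(2)] by (intro image_eqI[of _ _ v]) simp_all
    then have "(Vertex(j := Middle j)) ` {1..n} - ((\<lambda>v. Vertex (?\<mu> v)) ` {1..n} \<union>
        (\<lambda>v. Vertex (?\<mu> v)) ` {1..n}) = {Middle j :: nat label}"
      using ij(2) by (auto split: if_splits)
    then show ?case by simp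
  qed (auto simp: ne)
qed

section \<open>Idempotents of the twisted product\<close>

lemma mult_twisted_partition_monoid:
  "(i, a) \<otimes>\<^bsub>twisted_product (partition_monoid n) \<Phi>\<^esub> (j, b) =
     (i + j + int (\<Phi> a b), partition_mult n a b)"
  by (simp add: twisted_product_def partition_monoid_def)

lemma idempotents_twisted_partition_monoid:
  "(i, a) \<in> idempotents (twisted_product (partition_monoid n) \<Phi>) \<longleftrightarrow>
     partition_on (outer_vertices n) a \<and> partition_mult n a a = a \<and> i = - int (\<Phi> a a)"
  unfolding idempotents_def mem_Collect_eq mult_twisted_partition_monoid
  by (auto simp: twisted_product_def partition_monoid_def)

section \<open>Generating the singular part\<close>

text \<open>A sliding puzzle with at least one free place, solved by induction on the number of
  misplaced \<open>k\<close>. Move some misplaced \<open>k\<close> to its target, first evicting any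
  occupant to a free place.\<close>

lemma slide_injection:
  assumes fin: "finite T" "finite N" "card T < card N"
    and cong: "\<And>x x'. P x \<Longrightarrow> (\<And>k. k \<in> T \<Longrightarrow> x k = x' k) \<Longrightarrow> P x'"
    and move: "\<And>x k q. P x \<Longrightarrow> inj_on x T \<Longrightarrow> x ` T \<subseteq> N \<Longrightarrow> k \<in> T \<Longrightarrow> q \<in> N \<Longrightarrow> q \<notin> x ` T \<Longrightarrow>
      P (x(k := q))"
    and y: "inj_on y T" "y ` T \<subseteq> N"
  shows "P x \<Longrightarrow> inj_on x T \<Longrightarrow> x ` T \<subseteq> N \<Longrightarrow> P y"
proof (induction "card {k \<in> T. x k \<noteq> y k}" arbitrary: x rule: less_induct)
  case (less x)
  have move_inj: "inj_on (z(k := q)) T \<and> (z(k := q)) ` T \<subseteq> N"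
    if "inj_on z T" "z ` T \<subseteq> N" "q \<in> N" "q \<notin> z ` T" for z k q
    using that by (auto simp: inj_on_def)
  have finish: "P y" if "P z" "inj_on z T" "z ` T \<subseteq> N" "k \<in> T" "x k \<noteq> y k" "z k = y k"
    "\<And>l. l \<in> T \<Longrightarrow> x l = y l \<Longrightarrow> z l = y l" for z k
  proof -
    have "card {k \<in> T. z k \<noteq> y k} < card {k \<in> T. x k \<noteq> y k}"
      using that fin(1) by (intro psubset_card_mono) auto
    then show ?thesis using less.hyps that by blast
  qed
  show ?case
  proof (cases "\<exists>k\<in>T. x k \<noteq> y k")
    case False
    then show ?thesis using cong[OF less.prems(1)] by blast
  next
    case True
    then obtain k where k: "k \<in> T" "x k \<noteq> y k" by blast
    have yk: "y k \<in> N" using y k by blast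
    show ?thesis
    proof (cases "y k \<in> x ` T")
      case False
      show ?thesis
        by (rule finish[of "x(k := y k)" k])
          (use move[OF less.prems k(1) yk False] move_inj[OF less.prems(2,3) yk False] k
            in \<open>simp_all del: fun_upd_apply\<close>, simp_all)
    next
      case True
      then obtain l where l: "l \<in> T" "x l = y k" by auto
      have "card (x ` T) < card N" using card_image_le[OF fin(1), of x] fin(3) by simp
      then obtain q where q: "q \<in> N" "q \<notin> x ` T"
        using card_mono[of "x ` T" N] fin(1) by (metis finite_imageI not_le subsetI)
      let ?z = "x(l := q)"
      have z: "P ?z" "inj_on ?z T" "?z ` T \<subseteq> N"
        using move[OF less.prems l(1) q] move_inj[OF less.prems(2,3) q] by auto
      have free: "y k \<notin> ?z ` T"
      proof -
        have "?z ` T \<subseteq> insert q (x ` (T - {l}))" by auto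
        moreover have "x l \<notin> x ` (T - {l})"
          using less.prems(2) l(1) by (auto dest: inj_onD)
        moreover have "q \<noteq> x l" using q(2) l(1) by blast
        ultimately show ?thesis using l(2) by auto
      qed
      \<comment> \<open>The evicted \<open>l\<close> was misplaced too, as \<open>y\<close> is
        injective, so its move does not raise the count.\<close>
      have "y l \<noteq> x l" using l k y(1) by (metis inj_onD)
      then show ?thesis
        by (intro finish[of "?z(k := y k)" k])
          (use move[OF z k(1) yk free] move_inj[OF z(2,3) yk free] k
            in \<open>simp_all del: fun_upd_apply\<close>, auto)
    qed
  qed
qed

text \<open>Stated for any submonoid \<open>H\<close> containing the idempotents, so that it applies
  to each member of the intersection that forms the hull.\<close>

lemma singular_in_submonoid:
  fixes n :: nat
  defines "G \<equiv> twisted_product (partition_monoid n) (canonical_twisting n)"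
  assumes "n \<ge> 2" and H: "submonoid H G" "idempotents G \<subseteq> H" and a: "a \<in> Sing n"
  shows "(k, a) \<in> H"
proof -
  have mult: "(i + j + int (canonical_twisting n a b), partition_mult n a b) \<in> H"
    if "(i, a) \<in> H" "(j, b) \<in> H" for i j a b
    using submonoid.m_closed[OF H(1) that] unfolding G_def mult_twisted_partition_monoid .
  have idem: "(- int (canonical_twisting n a a), a) \<in> H"
    if "partition_on (outer_vertices n) a" "partition_mult n a a = a" for a
    using H(2) that unfolding G_def by (auto simp: idempotents_twisted_partition_monoid)
  \<comment> \<open>The free counter of \<open>a\<close> compensates for both \<open>l\<close> and
    the twisting.\<close>
  have right: "\<forall>k. (k, partition_mult n a b) \<in> H" if "\<forall>k. (k, a) \<in> H" "(l, b) \<in> H" for a b l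
  proof
    fix k
    show "(k, partition_mult n a b) \<in> H"
      using mult[of "k - l - int (canonical_twisting n a b)" a l b] that by simp
  qed
  have left: "\<forall>k. (k, partition_mult n a b) \<in> H" if "(l, a) \<in> H" "\<forall>k. (k, b) \<in> H" for a b l
  proof
    fix k
    show "(k, partition_mult n a b) \<in> H"
      using mult[of l a "k - l - int (canonical_twisting n a b)" b] that by simp
  qed
  have merge: "(k, transformation n (merge i j)) \<in> H"
    if ij: "i \<in> {1..n}" "j \<in> {1..n}" "i \<noteq> j" for i j k
  proof -
    define e where "e = fibers n (Vertex(j := Upper j)) (Vertex(j := Lower j :: nat label))"
    define f where "f = transformation n (merge i j)"
    define g where "g = fibers n Vertex (\<lambda>v. Vertex (merge i j v) :: nat label)"
    define t where
      "t = fibers n (\<lambda>v. Vertex (merge i j v)) (\<lambda>v. Vertex (merge i j v) :: nat label)"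
    note products = merge_products[OF ij, folded e_def f_def g_def t_def]
    have part: "partition_on (outer_vertices n) b" if "b \<in> {e, f, g, t}" for b
      using that partition_on_fibers
      by (auto simp: e_def f_def g_def t_def transformation_def upper_diagram_def)
    have e: "(-1, e) \<in> H" and f: "(0, f) \<in> H" and g: "(0, g) \<in> H" and t: "(0, t) \<in> H"
      using idem[of e] idem[of f] idem[of g] idem[of t] part products by simp_all
    have "(1, t) \<in> H" using mult[OF f g] products by simp
    moreover have "(-1, f) \<in> H" using mult[OF t e] products by simp
    then have "(-1, t) \<in> H" using mult[OF _ t, of "-1" f] products by simp
    \<comment> \<open>As \<open>t\<close> is idempotent with twisting 0, multiplying by
      \<open>(1, t)\<close> or \<open>(-1, t)\<close> shifts the counter by one either way.\<close>
    ultimately have "(k, t) \<in> H" for k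
    proof (induction k rule: int_induct[where k = 0])
      case base
      show ?case by (rule t)
    next
      case (step1 i)
      then show ?case using mult[of i t 1 t] products by simp
    next
      case (step2 i)
      then show ?case using mult[of i t "-1" t] products by simp
    qed
    then show ?thesis using right[of t "-1" e] e products f_def by simp
  qed
  have part: "partition_on (outer_vertices n) a" using a by (simp add: Sing_iff)
  obtain \<kappa> \<kappa>' :: "nat \<Rightarrow> vertex set" where a_eq: "a = fibers n \<kappa> \<kappa>'"
    using partition_eq_fibers[OF part] .
  define T where "T = \<kappa> ` {1..n} \<inter> \<kappa>' ` {1..n}"
  define P where "P x \<longleftrightarrow> (\<forall>k. (k, upper_diagram n T \<kappa> x) \<in> H)" for x
  have fin: "finite T" and card_T: "card T < card {1..n}"
    using Sing_card_less a unfolding a_eq T_def by auto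
  let ?x = "representative n \<kappa>" and ?y = "representative n \<kappa>'"
  have x: "?x k \<in> {1..n}" "\<kappa> (?x k) = k" if "k \<in> T" for k
    using representative[of k \<kappa> n] that by (auto simp: T_def)
  have y: "?y k \<in> {1..n}" "\<kappa>' (?y k) = k" if "k \<in> T" for k
    using representative[of k \<kappa>' n] that by (auto simp: T_def)
  have x_inj: "inj_on ?x T" by (rule inj_onI) (metis x(2))
  have y_inj: "inj_on ?y T" by (rule inj_onI) (metis y(2))
  have cong: "P z" if "P x" "\<And>k. k \<in> T \<Longrightarrow> x k = z k" for x z
    using that upper_diagram_cong[of T x z n \<kappa>] by (simp add: P_def)
  have merge_mult: "partition_mult n (upper_diagram n T \<kappa> z) (transformation n (merge q p)) =
      upper_diagram n T \<kappa> (\<lambda>k. merge q p (z k))"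
    if "z ` T \<subseteq> {1..n}" "q \<in> {1..n}" for z p q
    using upper_diagram_transformation[of n \<kappa> T z "merge q p"] that
    by (auto simp: merge_def image_subset_iff)
  have move: "P (z(k := q))"
    if z: "P z" "inj_on z T" "z ` T \<subseteq> {1..n}" and k: "k \<in> T" and q: "q \<in> {1..n}" "q \<notin> z ` T"
    for z k q
  proof -
    have zk: "z k \<in> {1..n}" "q \<noteq> z k" using z(3) k q by auto
    \<comment> \<open>Merging \<open>z k\<close> into \<open>q\<close> moves the endpoint of block
      \<open>k\<close> to \<open>q\<close>; no other endpoint equals \<open>z k\<close>, by
      injectivity.\<close>
    have "P (\<lambda>l. merge q (z k) (z l))"
      using right[of "upper_diagram n T \<kappa> z"] z(1) merge[OF q(1) zk]
      unfolding P_def merge_mult[OF z(3) q(1), symmetric] by blast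
    then show ?thesis
      by (rule cong) (use z(2) k in \<open>auto simp: merge_def dest: inj_onD\<close>)
  qed
  have "P ?x"
  proof -
    have "card (?x ` T) < card {1..n}" using card_image_le[OF fin, of ?x] card_T by simp
    then obtain j where j: "j \<in> {1..n}" "j \<notin> ?x ` T"
      using card_mono[of "?x ` T" "{1..n}"] fin by (metis finite_imageI not_le subsetI)
    obtain i where i: "i \<in> {1..n}" "i \<noteq> j"
      using \<open>n \<ge> 2\<close> that[of 1] that[of 2] by (cases "j = 1") auto
    have "(- int (canonical_twisting n (upper_diagram n T \<kappa> ?x) (upper_diagram n T \<kappa> ?x)),
        upper_diagram n T \<kappa> ?x) \<in> H"
      using x by (intro idem upper_diagram_idempotent)
        (simp_all add: upper_diagram_def partition_on_fibers)
    \<comment> \<open>No endpoint equals \<open>j\<close>, so this merge fixes all endpoints: the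
      idempotent absorbs it and thereby acquires every counter.\<close>
    then have "P (\<lambda>k. merge i j (?x k))"
      using left merge[OF i(1) j(1) i(2)] x(1) merge_mult[of ?x i j] i(1)
      unfolding P_def by (metis image_subsetI)
    then show ?thesis
      by (rule cong) (use j in \<open>auto simp: merge_def\<close>)
  qed
  have "P ?y"
  proof (rule slide_injection[where P = P, OF fin _ card_T])
    show "P z'" if "P z" "\<And>k. k \<in> T \<Longrightarrow> z k = z' k" for z z' using that by (rule cong)
    show "P (z(k := q))"
      if "P z" "inj_on z T" "z ` T \<subseteq> {1..n}" "k \<in> T" "q \<in> {1..n}" "q \<notin> z ` T" for z k q
      by (rule move[OF that])
    show "inj_on ?x T" "inj_on ?y T" "P ?x" by fact+
    show "?x ` T \<subseteq> {1..n}" "?y ` T \<subseteq> {1..n}" using x(1) y(1) by blast+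
  qed simp
  moreover have "(- int (canonical_twisting n (lower_diagram n T \<kappa>' ?y) (lower_diagram n T \<kappa>' ?y)),
      lower_diagram n T \<kappa>' ?y) \<in> H"
    using y by (intro idem lower_diagram_idempotent)
      (simp_all add: lower_diagram_def partition_on_fibers)
  ultimately show ?thesis
    using right fibers_factorization[OF T_def, of ?y] y unfolding P_def a_eq by metis
qed

section \<open>The submonoid generated by the idempotents\<close>

theorem theorem8p7:
  fixes n :: nat
  assumes "n \<ge> 2"
  shows "generated_submonoid (twisted_product (partition_monoid n) (canonical_twisting n))
           (idempotents (twisted_product (partition_monoid n) (canonical_twisting n)))
       = {(0, \<one>\<^bsub>partition_monoid n\<^esub>)} \<union> (UNIV :: int set) \<times> Sing n"
proof -
  let ?G = "twisted_product (partition_monoid n) (canonical_twisting n)"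
  let ?R = "{(0, \<one>\<^bsub>partition_monoid n\<^esub>)} \<union> (UNIV :: int set) \<times> Sing n"
  have one: "\<one>\<^bsub>partition_monoid n\<^esub> = transformation n (\<lambda>v. v)"
    by (simp add: partition_monoid_def transformation_id)
  have one_part: "partition_on (outer_vertices n) (transformation n (\<lambda>v. v))"
    unfolding transformation_def upper_diagram_def by (rule partition_on_fibers)
  have one_mult: "partition_mult n (transformation n (\<lambda>v. v)) (transformation n (\<lambda>v. v)) =
      transformation n (\<lambda>v. v)"
    "canonical_twisting n (transformation n (\<lambda>v. v)) (transformation n (\<lambda>v. v)) = 0"
    using transformation_mult[of n "\<lambda>v. v" "\<lambda>v. v"] by simp_all
  have Sing_part: "partition_on (outer_vertices n) a" if "a \<in> Sing n" for a
    using that by (simp add: Sing_iff)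
  have "submonoid ?R ?G"
  proof
    show "?R \<subseteq> carrier ?G"
      using Sing_part one_part
      by (auto simp: one) (auto simp: twisted_product_def partition_monoid_def)
    show "\<one>\<^bsub>?G\<^esub> \<in> ?R" by (simp add: twisted_product_def)
    show "p \<otimes>\<^bsub>?G\<^esub> q \<in> ?R" if "p \<in> ?R" "q \<in> ?R" for p q
      using that Sing_part one_part Sing_ideal
      by (cases p; cases q) (auto simp: mult_twisted_partition_monoid one one_mult)
  qed
  moreover have "idempotents ?G \<subseteq> ?R"
  proof
    fix p assume "p \<in> idempotents ?G"
    then obtain i a where p: "p = (i, a)" and a: "partition_on (outer_vertices n) a"
      "partition_mult n a a = a" "i = - int (canonical_twisting n a a)"
      using idempotents_twisted_partition_monoid by (metis surj_pair)
    show "p \<in> ?R"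
    proof (cases "a \<in> Sing n")
      case False
      then obtain \<pi> where \<pi>: "bij_betw \<pi> {1..n} {1..n}" and a_eq: "a = transformation n \<pi>"
        using a(1) by (auto simp: Sing_iff)
      have range: "\<pi> v \<in> {1..n}" if "v \<in> {1..n}" for v
        using that \<pi> by (auto dest: bij_betwE)
      have eq: "fibers n (\<lambda>v. Vertex (\<pi> (\<pi> v))) (Vertex :: nat \<Rightarrow> nat label) =
          fibers n (\<lambda>v. Vertex (\<pi> v)) (Vertex :: nat \<Rightarrow> nat label)"
        using transformation_mult[of n \<pi> \<pi>, OF range range] a(2)
        by (simp add: a_eq transformation_def upper_diagram_def)
      have "\<pi> v = v" if v: "v \<in> {1..n}" for v
      proof -
        \<comment> \<open>The vertices \<open>Top v\<close> and \<open>Bot (\<pi> v)\<close> share a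
          block on one side of \<open>eq\<close>, hence on the other. Injectivity of
          \<open>\<pi>\<close> then gives \<open>\<pi> v = v\<close>.\<close>
        have "\<pi> (\<pi> v) = \<pi> v"
          using same_fiber_iff[of "Top v" n "Bot (\<pi> v)" "\<lambda>v. Vertex (\<pi> (\<pi> v))"
              "Vertex :: nat \<Rightarrow> nat label"]
            same_fiber_iff[of "Top v" n "Bot (\<pi> v)" "\<lambda>v. Vertex (\<pi> v)"
              "Vertex :: nat \<Rightarrow> nat label"] eq v range[OF v]
          by simp
        then show ?thesis using \<pi> v range[OF v] by (auto simp: bij_betw_def dest: inj_onD)
      qed
      then have "a = transformation n (\<lambda>v. v)" unfolding a_eq by (rule transformation_cong)
      then show ?thesis using one_mult p a(3) one by simp
    qed (simp add: p)
  qed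
  moreover have "?R \<subseteq> H" if "submonoid H ?G" "idempotents ?G \<subseteq> H" for H
    using singular_in_submonoid[OF assms that] submonoid.one_closed[OF that(1)]
    by (auto simp: twisted_product_def)
  \<comment> \<open>The hull is the intersection of all submonoids containing the idempotents;
    \<open>?R\<close> is one of them and lies in each.\<close>
  ultimately show ?thesis
    unfolding generated_submonoid_def hull_def by (intro antisym Inter_lower Inter_greatest) auto
qed

end
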